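(* Let $A$ be an abelian group and let $f,g:A\rightarrow\mathbf{Z}$ be epimorphisms. Then $f(\ker g)=g(\ker f)$ (as subgroups of $\mathbf{Z}$), so that $$\frac{\ker g}{\ker f\cap\ker g}\cong f(\ker g)=g(\ker f)\cong\frac{\ker f}{\ker f\cap\ker g}.$$
   Context: $\mathbf{Z}$ is the additive group of integers. *)

theory Defs
  imports "HOL-Algebra.Elementary_Groups"
begin

end

theory Submission
  imports Defs
begin

text \<open>
  The subgroups \<open>f (ker g)\<close> and \<open>g (ker f)\<close> of the integers collect the \<open>n\<close> for
  which \<open>(n, 0)\<close>, respectively \<open>(0, n)\<close>, lies in the image of \<open>(f, g)\<close>. Surjectivity lets one
  pass from the first kind of pair to the second: choose \<open>b\<close> with \<open>g b = 1\<close> and put \<open>p = f b\<close>. If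
  \<open>x\<close> maps to \<open>(n, 0)\<close>, then \<open>n b - p x\<close> maps to \<open>(n p - p n, n) = (0, n)\<close>. The integer \<open>p\<close> thus
  serves as a multiplier in the group, which is where the codomain being the integers enters: over
  a general codomain Goursat's lemma would only give isomorphic quotients by the two images. This
  is \<open>image_kernel_subset_image_kernel\<close>, and the equality follows by exchanging
  \<open>f\<close> and \<open>g\<close>.

  The two isomorphisms are the first isomorphism theorem applied to the restriction of one
  homomorphism to the kernel of the other (\<open>restricted_FactGroup_iso\<close>).
\<close>

lemma image_kernel_subset_image_kernel:
  fixes G :: "('a, 'b) monoid_scheme" and f g :: "'a \<Rightarrow> int"
  assumes f: "group_hom G integer_group f" and g: "group_hom G integer_group g"
    and surj: "g ` carrier G = UNIV"
  shows "f ` kernel G integer_group g \<subseteq> g ` kernel G integer_group f"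
proof
  interpret f: group_hom G integer_group f by (rule f)
  interpret g: group_hom G integer_group g by (rule g)
  fix n assume "n \<in> f ` kernel G integer_group g"
  then obtain x where x: "x \<in> carrier G" "g x = 0" "f x = n"
    by (auto simp: kernel_def)
  obtain b where b: "b \<in> carrier G" "g b = 1"
    using surj by (metis UNIV_I imageE)
  \<comment> \<open>In additive notation, \<open>y = n b - p x\<close> with \<open>p = f b\<close>.\<close>
  define y where "y = b [^]\<^bsub>G\<^esub> n \<otimes>\<^bsub>G\<^esub> inv\<^bsub>G\<^esub> (x [^]\<^bsub>G\<^esub> f b)"
  have "y \<in> carrier G"
    using x b by (simp add: y_def)
  moreover have "f y = 0" "g y = n"
    using x b by (simp_all add: y_def f.hom_int_pow g.hom_int_pow)
  ultimately show "n \<in> g ` kernel G integer_group f"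
    by (force simp: kernel_def)
qed

lemma (in group_hom) restricted_FactGroup_iso:
  assumes "subgroup I G"
  shows "(G\<lparr>carrier := I\<rparr>) Mod (kernel G H h \<inter> I) \<cong> H\<lparr>carrier := h ` I\<rparr>"
    and "H\<lparr>carrier := h ` I\<rparr> \<cong> (G\<lparr>carrier := I\<rparr>) Mod (kernel G H h \<inter> I)"
proof -
  interpret r: group_hom "G\<lparr>carrier := I\<rparr>" "H\<lparr>carrier := h ` I\<rparr>" h
    by (rule induced_group_hom[OF assms])
  have ker: "kernel (G\<lparr>carrier := I\<rparr>) (H\<lparr>carrier := h ` I\<rparr>) h = kernel G H h \<inter> I"
    using subgroup.subset[OF assms] by (auto simp: kernel_def)
  show iso: "(G\<lparr>carrier := I\<rparr>) Mod (kernel G H h \<inter> I) \<cong> H\<lparr>carrier := h ` I\<rparr>"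
    using r.FactGroup_iso by (simp add: ker)
  have "group ((G\<lparr>carrier := I\<rparr>) Mod (kernel G H h \<inter> I))"
    using normal.factorgroup_is_group[OF r.normal_kernel] by (simp add: ker)
  then show "H\<lparr>carrier := h ` I\<rparr> \<cong> (G\<lparr>carrier := I\<rparr>) Mod (kernel G H h \<inter> I)"
    using iso by (rule group.iso_sym)
qed

theorem theorem1:
  fixes A :: "('a, 'b) monoid_scheme" and f g :: "'a \<Rightarrow> int"
  assumes "comm_group A"
    and "f \<in> epi A integer_group"
    and "g \<in> epi A integer_group"
  shows "subgroup (f ` kernel A integer_group g) integer_group
    \<and> subgroup (g ` kernel A integer_group f) integer_group
    \<and> f ` kernel A integer_group g = g ` kernel A integer_group f
    \<and> (A\<lparr>carrier := kernel A integer_group g\<rparr>)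
          Mod (kernel A integer_group f \<inter> kernel A integer_group g)
        \<cong> integer_group\<lparr>carrier := f ` kernel A integer_group g\<rparr>
    \<and> integer_group\<lparr>carrier := g ` kernel A integer_group f\<rparr>
        \<cong> (A\<lparr>carrier := kernel A integer_group f\<rparr>)
          Mod (kernel A integer_group f \<inter> kernel A integer_group g)"
proof -
  have "group A"
    using assms(1) by (rule comm_group.axioms)
  then interpret f: group_hom A integer_group f
    using assms(2) by (simp add: group_hom_def group_hom_axioms_def epi_def)
  interpret g: group_hom A integer_group g
    using \<open>group A\<close> assms(3) by (simp add: group_hom_def group_hom_axioms_def epi_def)
  have surj: "f ` carrier A = UNIV" "g ` carrier A = UNIV"
    using assms(2,3) by (simp_all add: epi_def)
  have "f ` kernel A integer_group g = g ` kernel A integer_group f"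
    using image_kernel_subset_image_kernel[OF f.group_hom_axioms g.group_hom_axioms surj(2)]
      image_kernel_subset_image_kernel[OF g.group_hom_axioms f.group_hom_axioms surj(1)]
    by (rule subset_antisym)
  then show ?thesis
    using f.subgroup_img_is_subgroup[OF g.subgroup_kernel]
      g.subgroup_img_is_subgroup[OF f.subgroup_kernel]
      f.restricted_FactGroup_iso(1)[OF g.subgroup_kernel]
      g.restricted_FactGroup_iso(2)[OF f.subgroup_kernel]
    by (simp add: Int_commute)
qed

end
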